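(* Let $q$ be an odd prime power and $\ell>1$ an odd integer. Then the commutative semifield $P(q,\ell)$ is isotopic to a BHB presemifield $B(p,m,s,\beta)$ (for suitable parameters $p,m,s,\beta$ and a suitable $\omega$ as in the definition of that family).
   Context: Write $\ell=2k+1$. $P(q,\ell)=(\mathbb{F}_{q^{2\ell}},+,* )$ has multiplication $x*y=\tfrac12(xy+x^{q^\ell}y^{q^\ell})+\tfrac14G(xy^{q^2}+x^{q^2}y)$, where $G(x)=\sum_{i=1}^{k}(-1)^i(x-x^{q^\ell})^{q^{2i}}+\sum_{j=1}^{k-1}(-1)^{k+j}(x-x^{q^\ell})^{q^{2j+1}}$. A BHB presemifield $B(p,m,s,\beta)=(\mathbb{F}_{p^{2m}},+,\star)$ is defined for $p$ an odd prime, $m>1$, $0<s<2m$, $\omega\in\mathbb{F}_{p^{2m}}\setminus\mathbb{F}_{p^m}$ with $\omega^{p^m}=-\omega$, and $\beta\in\mathbb{F}_{p^{2m}}^*$ with $\beta^{(p^{2m}-1)/\gcd(p^m+1,p^s+1)}\neq1$, under the condition that there is no $a\in\mathbb{F}_{p^{2m}}^*$ with $a+a^{p^m}=a+a^{p^s}=0$; its multiplication is $x\star y=xy^{p^m}+x^{p^m}y+[\beta(xy^{p^s}+x^{p^s}y)+\beta^{p^m}(xy^{p^s}+x^{p^s}y)^{p^m}]\omega$. Two presemifields (additive group of a field with a multiplication satisfying both distributive laws and no zero divisors) $(\mathbb{F},+,\bullet)$, $(\mathbb{F},+,\star)$ of characteristic $p$ are isotopic if there are $\mathbb{F}_p$-linear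 permutations $M,N,L$ of $\mathbb{F}$ with $M(x)\star N(y)=L(x\bullet y)$ for all $x,y$.
   Formalization: With both sums in G starting at 1 the claim fails (e.g. q=11, ℓ=5 gives zero divisors); it is proved for all q, ℓ with the sums starting at 0, and for the sums starting at 1 whenever that multiplication defines a presemifield. *)

theory Defs
  imports "HOL-Number_Theory.Number_Theory" "HOL-Library.Cardinality"
begin

text \<open>The finite field of order \<open>N\<close> is any type \<open>'a\<close> of classes \<open>field\<close> and \<open>finite\<close> with
  \<open>CARD('a) = N\<close>.\<close>

definition presemifield :: "('a::field \<Rightarrow> 'a \<Rightarrow> 'a) \<Rightarrow> bool" where
  "presemifield f \<longleftrightarrow>
     (\<forall>x y z. f x (y + z) = f x y + f x z) \<and>
     (\<forall>x y z. f (x + y) z = f x z + f y z) \<and>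
     (\<forall>x y. f x y = 0 \<longrightarrow> x = 0 \<or> y = 0)"

text \<open>In characteristic \<open>p\<close> the prime field is the image of the natural numbers.\<close>

definition prime_field_linear :: "('a::field \<Rightarrow> 'a) \<Rightarrow> bool" where
  "prime_field_linear M \<longleftrightarrow>
     (\<forall>x y. M (x + y) = M x + M y) \<and> (\<forall>c\<in>range of_nat. \<forall>x. M (c * x) = c * M x)"

definition isotopic :: "('a::field \<Rightarrow> 'a \<Rightarrow> 'a) \<Rightarrow> ('a \<Rightarrow> 'a \<Rightarrow> 'a) \<Rightarrow> bool" where
  "isotopic f g \<longleftrightarrow> presemifield f \<and> presemifield g \<and>
     (\<exists>M N L. prime_field_linear M \<and> bij M \<and> prime_field_linear N \<and> bij N \<and>
        prime_field_linear L \<and> bij L \<and> (\<forall>x y. g (M x) (N y) = L (f x y)))"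

text \<open>
  The map \<open>G\<close> of the semifield \<open>P(q,\<ell>)\<close>, with \<open>\<ell> = 2 * k + 1\<close>. The extra argument \<open>r\<close> is the index
  at which both sums start.

  With \<open>r = 0\<close> one gets a semifield with identity \<open>1\<close>: putting \<open>t = x - x ^ (q ^ \<ell>)\<close>, so that
  \<open>t ^ (q ^ \<ell>) = - t\<close>, the two sums telescope to \<open>G (x + x ^ (q\<^sup>2)) = 2 * t\<close>.

  The formula is also printed with \<open>r = 1\<close>. That multiplication is the one for \<open>r = 0\<close> followed by an
  additive map, which for some \<open>q\<close> and \<open>\<ell>\<close> is not injective, and then there are zero divisors. An
  example is \<open>q = 11\<close> and \<open>\<ell> = 5\<close>: if \<open>u ^ (q ^ 5) = - u\<close>, then
  \<open>G (u / 2) = u ^ (q ^ 4) - u ^ (q ^ 3) - u ^ (q\<^sup>2)\<close>, and this vanishes on the solutions of \<open>u ^ q = 8 * u\<close>,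
  since \<open>8 ^ 5 = -1\<close> and \<open>8\<^sup>2 = 8 + 1\<close> modulo 11.\<close>

definition P_G :: "nat \<Rightarrow> nat \<Rightarrow> nat \<Rightarrow> 'a::field \<Rightarrow> 'a" where
  "P_G r q l x =
     (let k = (l - 1) div 2 in
        (\<Sum>i\<in>{r..k}. (-1) ^ i * (x - x ^ (q ^ l)) ^ (q ^ (2 * i))) +
        (\<Sum>j\<in>{r..k-1}. (-1) ^ (k + j) * (x - x ^ (q ^ l)) ^ (q ^ (2 * j + 1))))"

definition P_mult :: "nat \<Rightarrow> nat \<Rightarrow> nat \<Rightarrow> 'a::field \<Rightarrow> 'a \<Rightarrow> 'a" where
  "P_mult r q l x y =
     1/2 * (x * y + x ^ (q ^ l) * y ^ (q ^ l)) +
     1/4 * P_G r q l (x * y ^ (q^2) + x ^ (q^2) * y)"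

text \<open>Inside the field of order \<open>p ^ (2 * m)\<close>, the subfield of order \<open>p ^ m\<close> consists of the fixed
  points of \<open>x \<mapsto> x ^ (p ^ m)\<close>.\<close>

definition BHB_parameters :: "nat \<Rightarrow> nat \<Rightarrow> nat \<Rightarrow> 'a::{field,finite} \<Rightarrow> 'a \<Rightarrow> bool" where
  "BHB_parameters p m s \<beta> \<omega> \<longleftrightarrow>
     prime p \<and> odd p \<and> m > 1 \<and> 0 < s \<and> s < 2 * m \<and> CARD('a) = p ^ (2 * m) \<and>
     \<omega> \<notin> {x. x ^ (p ^ m) = x} \<and> \<omega> ^ (p ^ m) = - \<omega> \<and>
     \<beta> \<noteq> 0 \<and> \<beta> ^ ((p ^ (2 * m) - 1) div gcd (p ^ m + 1) (p ^ s + 1)) \<noteq> 1 \<and>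
     \<not> (\<exists>a::'a. a \<noteq> 0 \<and> a + a ^ (p ^ m) = 0 \<and> a + a ^ (p ^ s) = 0)"

definition BHB_mult :: "nat \<Rightarrow> nat \<Rightarrow> nat \<Rightarrow> 'a::field \<Rightarrow> 'a \<Rightarrow> 'a \<Rightarrow> 'a \<Rightarrow> 'a" where
  "BHB_mult p m s \<beta> \<omega> x y =
     x * y ^ (p ^ m) + x ^ (p ^ m) * y +
     (\<beta> * (x * y ^ (p ^ s) + x ^ (p ^ s) * y) +
      \<beta> ^ (p ^ m) * (x * y ^ (p ^ s) + x ^ (p ^ s) * y) ^ (p ^ m)) * \<omega>"

end

theory Submission
  imports Defs "HOL-Computational_Algebra.Polynomial"
begin

text \<open>
  Write \<open>cj x = x ^ (q ^ \<ell>)\<close> and choose \<open>u\<close> in the subfield of order \<open>q\<^sup>2\<close> with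
  \<open>u ^ (q + 1) = -1\<close>, so that \<open>cj u = - 1 / u\<close> because \<open>\<ell>\<close> is odd. Substituting
  \<open>x / u + cj x\<close> and \<open>y + u * cj y\<close> into the product of \<open>P(q,\<ell>)\<close> turns the part fixed by \<open>cj\<close> into
  \<open>x * cj y + cj x * y\<close> and the argument of \<open>G\<close> into one whose \<open>cj\<close>-antifixed part is
  \<open>z / u + u * cj z\<close> with \<open>z = x * y ^ (q\<^sup>2) + x ^ (q\<^sup>2) * y\<close>. This is the BHB product with
  \<open>p ^ m = q ^ \<ell>\<close>, \<open>p ^ s = q\<^sup>2\<close> and \<open>\<beta> = 1 / (u * \<omega>)\<close>, followed by a linear map that is the identity on the
  fixed part and essentially \<open>G\<close> on the antifixed part. For the sums starting at \<open>0\<close> that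
  map is injective by telescoping; for those starting at \<open>1\<close> its injectivity amounts to the
  absence of zero divisors, since the BHB product is onto in each argument.
\<close>

section \<open>Isotopisms onto a presemifield\<close>

lemma additive_imp_prime_field_linear:
  fixes M :: "'a::field \<Rightarrow> 'a"
  assumes "additive M"
  shows "prime_field_linear M"
proof -
  interpret additive M by fact
  have "M (of_nat n * x) = of_nat n * M x" for n x
    by (induction n) (simp_all add: add zero distrib_right)
  then show ?thesis
    by (auto simp: prime_field_linear_def add)
qed

lemma additive_inv:
  fixes M :: "'a::field \<Rightarrow> 'a"
  assumes "additive M" and "bij M"
  shows "additive (inv_into UNIV M)"
proof -
  interpret additive M by fact
  show ?thesis
  proof
    fix x y
    have "M (inv_into UNIV M x + inv_into UNIV M y) = x + y"
      using assms(2) by (simp add: add bij_is_surj surj_f_inv_f)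
    then show "inv_into UNIV M (x + y) = inv_into UNIV M x + inv_into UNIV M y"
      using assms(2) by (metis bij_inv_eq_iff)
  qed
qed

lemma additive_injI:
  fixes M :: "'a::field \<Rightarrow> 'a"
  assumes "additive M" and "\<And>x. M x = 0 \<Longrightarrow> x = 0"
  shows "inj M"
proof (rule injI)
  interpret additive M by fact
  fix x y assume "M x = M y"
  then have "M (x - y) = 0" by (simp add: diff)
  then have "x - y = 0" by (rule assms(2))
  then show "x = y" by simp
qed

text \<open>\<open>isotopic\<close> asks for maps from \<open>f\<close> to \<open>g\<close>, while
  here they run from \<open>g\<close> to \<open>f\<close>, so inverses are taken. \<open>f\<close>
  inherits the presemifield laws from \<open>g\<close> through these bijections.\<close>

lemma isotopicI:
  fixes f g :: "'a::{field,finite} \<Rightarrow> 'a \<Rightarrow> 'a"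
  assumes g: "presemifield g"
    and M: "additive M" "inj M" and N: "additive N" "inj N" and L: "additive L" "inj L"
    and fg: "\<And>x y. f (M x) (N y) = L (g x y)"
  shows "isotopic f g"
proof -
  have bij: "bij M" "bij N" "bij L"
    using M(2) N(2) L(2) by (simp_all add: bij_def finite_UNIV_inj_surj)
  interpret M': additive "inv_into UNIV M" using M(1) bij(1) by (rule additive_inv)
  interpret N': additive "inv_into UNIV N" using N(1) bij(2) by (rule additive_inv)
  interpret L: additive L by fact
  have f: "f x y = L (g (inv_into UNIV M x) (inv_into UNIV N y))" for x y
    using fg[of "inv_into UNIV M x" "inv_into UNIV N y"] bij by (simp add: bij_is_surj surj_f_inv_f)
  have "x = 0 \<or> y = 0" if "f x y = 0" for x y
  proof -
    have "g (inv_into UNIV M x) (inv_into UNIV N y) = 0"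
      using that L(2) by (metis f L.zero injD)
    then have "inv_into UNIV M x = 0 \<or> inv_into UNIV N y = 0"
      using g by (auto simp: presemifield_def)
    then show ?thesis
      using bij by (metis M'.zero N'.zero bij_inv_eq_iff)
  qed
  then have "presemifield f"
    using g by (auto simp: presemifield_def f L.add M'.add N'.add)
  moreover have "g (inv_into UNIV M x) (inv_into UNIV N y) = inv_into UNIV L (f x y)" for x y
    using bij(3) by (simp add: f bij_is_inj)
  moreover have "additive (inv_into UNIV L)" using L(1) bij(3) by (rule additive_inv)
  ultimately show ?thesis
    unfolding isotopic_def
    using g bij M'.additive_axioms N'.additive_axioms
    by (blast intro: additive_imp_prime_field_linear bij_imp_bij_inv)
qed

text \<open>\<open>g 1\<close> is injective on a finite set, so every \<open>z\<close> is some
  \<open>g 1 y\<close>. A nonzero \<open>z\<close> with \<open>L z = 0\<close> would make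
  \<open>M 1\<close> and \<open>N y\<close> zero divisors of \<open>f\<close>.\<close>

lemma inj_if_presemifield:
  fixes f g :: "'a::{field,finite} \<Rightarrow> 'a \<Rightarrow> 'a"
  assumes f: "presemifield f" and g: "presemifield g"
    and M: "additive M" "inj M" and N: "additive N" "inj N" and L: "additive L"
    and fg: "\<And>x y. f (M x) (N y) = L (g x y)"
  shows "inj L"
proof (rule additive_injI[OF L])
  fix z assume "L z = 0"
  interpret g1: additive "g 1"
    using g by unfold_locales (simp add: presemifield_def)
  have "x = 0" if "g 1 x = 0" for x
    using g that unfolding presemifield_def by (metis zero_neq_one)
  then have "inj (g 1)"
    by (rule additive_injI[OF g1.additive_axioms])
  then obtain y where y: "g 1 y = z"
    by (metis finite_UNIV_inj_surj finite surjD)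
  have "f (M 1) (N y) = 0"
    using \<open>L z = 0\<close> by (simp add: fg y)
  then have "M 1 = 0 \<or> N y = 0"
    using f by (auto simp: presemifield_def)
  then have "y = 0"
    using M N by (metis additive.zero injD zero_neq_one)
  then show "z = 0"
    using y g1.zero by simp
qed

section \<open>Finite fields\<close>

text \<open>Multiplication by \<open>x\<close> permutes the nonzero elements, so it leaves their
  product unchanged.\<close>

lemma finite_field_power_card_minus_1:
  fixes x :: "'a::{field,finite}"
  assumes "x \<noteq> 0"
  shows "x ^ (CARD('a) - 1) = 1"
proof -
  have "(\<Prod>y\<in>UNIV - {0}. x * y) = (\<Prod>y\<in>UNIV - {0}. y)"
    by (rule prod.reindex_bij_witness[of _ "\<lambda>y. y / x" "\<lambda>y. x * y"]) (use assms in auto)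
  then have "x ^ (CARD('a) - 1) * (\<Prod>y\<in>UNIV - {0}. y) = 1 * (\<Prod>y\<in>UNIV - {0::'a}. y)"
    by (simp add: prod.distrib)
  then show ?thesis
    by (subst (asm) mult_cancel_right) simp
qed

text \<open>With \<open>n\<close> half of \<open>CARD('a) - 1\<close>, the polynomial
  \<open>X ^ n - 1\<close> has at most \<open>n\<close> roots, too few to cover all nonzero
  elements. At a nonroot \<open>g\<close>, the power \<open>g ^ n\<close> is a square root of 1
  other than 1.\<close>

lemma finite_field_exists_nonsquare:
  assumes "odd CARD('a::{field,finite})"
  shows "\<exists>g::'a. g \<noteq> 0 \<and> g ^ ((CARD('a) - 1) div 2) = -1"
proof -
  define n where "n = (CARD('a) - 1) div 2"
  have two: "CARD('a) \<ge> 2"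
    using card_mono[of UNIV "{0, 1::'a}"] by simp
  then have n: "2 * n = CARD('a) - 1" "n > 0"
    using assms unfolding n_def by presburger+
  define P :: "'a poly" where "P = monom 1 n - 1"
  have P: "P \<noteq> 0" "degree P \<le> n"
  proof -
    have "coeff P n = 1" using n by (simp add: P_def)
    then show "P \<noteq> 0" by auto
    show "degree P \<le> n"
      unfolding P_def by (intro degree_diff_le) (simp_all add: degree_monom_le)
  qed
  have "card {x. poly P x = 0} \<le> n"
    using card_poly_roots_bound[OF P(1)] P(2) by linarith
  also have "n < card (UNIV - {0::'a})"
    using n two by simp
  finally have "\<not> UNIV - {0} \<subseteq> {x. poly P x = 0}"
    by (metis card_mono finite leD)
  then obtain g :: 'a where g: "g \<noteq> 0" "g ^ n \<noteq> 1"
    by (auto simp: P_def poly_monom)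
  have "(g ^ n)\<^sup>2 = 1"
    using finite_field_power_card_minus_1[OF g(1)] n by (simp add: mult.commute flip: power_mult)
  then show ?thesis
    using g unfolding n_def[symmetric] by (auto simp: power2_eq_1_iff)
qed

lemma finite_field_CHAR:
  assumes "CARD('a::{field,finite}) = p ^ n" and "prime p"
  shows "CHAR('a) = p"
proof -
  have "CHAR('a) > 0"
    by (rule finite_imp_CHAR_pos) simp
  then have "prime CHAR('a)"
    by (rule prime_CHAR_semidom)
  moreover have "CHAR('a) dvd p ^ n"
    using CHAR_dvd_CARD[where 'a = 'a] assms by simp
  ultimately show ?thesis
    using assms(2) by (metis prime_dvd_power primes_dvd_imp_eq)
qed

section \<open>The isotopism\<close>

text \<open>Primes stand for conjugates: the first product is \<open>M x * N y\<close> for the maps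
  \<open>M\<close>, \<open>N\<close> below, the second its conjugate.\<close>

lemma trace_part_identity:
  fixes u v x x' y y' :: "'a::field"
  assumes "u * v = 1"
  shows "(v * x + x') * (y + u * y') + (x - u * x') * (y' - v * y) = 2 * (x * y' + x' * y)"
proof -
  have uv: "u * (v * c) = c" for c
    using assms by (simp flip: mult.assoc)
  show ?thesis
    by (simp add: algebra_simps uv)
qed

text \<open>\<open>w\<close> and \<open>z\<close> stand for \<open>fr x\<close> and
  \<open>fr y\<close>, primes for conjugates. The left side is the argument of \<open>G\<close>
  minus its conjugate.\<close>

lemma twisted_part_identity:
  fixes u v :: "'a::field"
  assumes "u * v = 1"
  shows "(v * x + x') * (z + u * z') + (v * w + w') * (y + u * y') -
      ((x - u * x') * (z' - v * z) + (w - u * w') * (y' - v * y)) =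
      2 * (v * (x * z + w * y) + u * (x' * z' + w' * y'))"
proof -
  have uv: "u * (v * c) = c" for c
    using assms by (simp flip: mult.assoc)
  show ?thesis
    by (simp add: algebra_simps uv)
qed

text \<open>This is \<open>G\<close> as a function of \<open>t = x - x ^ (q ^ l)\<close>, where
  \<open>l = 2 * k + 1\<close>.\<close>

definition P_H :: "nat \<Rightarrow> nat \<Rightarrow> nat \<Rightarrow> 'a::field \<Rightarrow> 'a" where
  "P_H r q k t =
     (\<Sum>i\<in>{r..k}. (-1) ^ i * t ^ (q ^ (2 * i))) +
     (\<Sum>j\<in>{r..k-1}. (-1) ^ (k + j) * t ^ (q ^ (2 * j + 1)))"

text \<open>These are the facts taken from the field of order \<open>q ^ (2 * l)\<close>:
  \<open>add_q\<close> reflects that \<open>q\<close> is a power of the characteristic,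
  \<open>card_power\<close> reflects the order.\<close>

locale quadratic_extension =
  fixes q l k :: nat and u :: "'a::field"
  assumes q_odd: "odd q"
    and l_eq: "l = 2 * k + 1" and k_pos: "k > 0"
    and add_q: "\<And>x y::'a. (x + y) ^ q = x ^ q + y ^ q"
    and card_power: "\<And>x::'a. x ^ (q ^ (2 * l)) = x"
    and two: "(2::'a) \<noteq> 0"
    and u_fixed: "u ^ (q\<^sup>2) = u" and u_norm: "u ^ (q + 1) = -1"
begin

abbreviation cj :: "'a \<Rightarrow> 'a" where "cj x \<equiv> x ^ (q ^ l)"
abbreviation fr :: "'a \<Rightarrow> 'a" where "fr x \<equiv> x ^ (q\<^sup>2)"
abbreviation v :: 'a where "v \<equiv> inverse u"

lemma q_pos: "q > 0"
  using q_odd by (rule odd_pos)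

lemma pow_add: "(x + y :: 'a) ^ (q ^ n) = x ^ (q ^ n) + y ^ (q ^ n)"
  by (induction n) (simp_all add: power_mult[of _ "q ^ _" q] mult.commute[of q] add_q)

lemma pow_minus: "(- x :: 'a) ^ (q ^ n) = - (x ^ (q ^ n))"
  using q_odd by simp

lemma pow_diff: "(x - y :: 'a) ^ (q ^ n) = x ^ (q ^ n) - y ^ (q ^ n)"
  using pow_add[of x "- y" n] by (simp add: pow_minus)

lemma pow_sum: "(\<Sum>i\<in>A. h i :: 'a) ^ (q ^ n) = (\<Sum>i\<in>A. h i ^ (q ^ n))"
  using q_pos by (induction A rule: infinite_finite_induct) (auto simp: pow_add)

lemma pow_pow: "(x ^ (q ^ i)) ^ (q ^ j) = (x::'a) ^ (q ^ (i + j))"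
  by (simp add: power_add power_mult)

lemma pow_sign: "((-1) ^ i * x :: 'a) ^ (q ^ n) = (-1) ^ i * x ^ (q ^ n)"
  by (cases "even i") (simp_all add: pow_minus)

lemma pow_2: "(2::'a) ^ (q ^ n) = 2"
  using pow_add[of 1 1 n] by simp

lemma cj_cj [simp]: "cj (cj x) = x"
  using card_power[of x] by (simp add: pow_pow mult_2)

lemma cj_fr: "cj (fr x) = fr (cj x)"
  by (simp add: mult.commute flip: power_mult)

lemma u_nonzero: "u \<noteq> 0"
  using u_norm by auto

lemma cj_u: "cj u = - v"
proof -
  have "u ^ (q ^ (2 * i)) = u" for i
  proof (induction i)
    case (Suc i)
    have "u ^ (q ^ (2 * Suc i)) = fr (u ^ (q ^ (2 * i)))"
      by (simp only: pow_pow mult_Suc_right add.commute)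
    then show ?case
      by (simp only: Suc u_fixed)
  qed simp
  then have "cj u = u ^ q"
    by (simp add: l_eq power_mult mult.commute[of q])
  moreover have "u ^ q * u = - 1"
    using u_norm by (simp add: mult.commute)
  ultimately show ?thesis
    using u_nonzero by (simp add: field_simps)
qed

lemma cj_v: "cj v = - u"
  using u_nonzero by (simp add: power_inverse cj_u)

lemma fr_v: "fr v = v"
  by (simp add: power_inverse u_fixed)

lemma eq_minus_self_iff: "x = - x \<longleftrightarrow> x = (0::'a)"
  using two by (metis add_eq_0_iff mult_2 mult_eq_0_iff neg_equal_0_iff_equal)

text \<open>An even number of applications of \<open>fr\<close> fixes \<open>a\<close>, hence so
  does the power \<open>q ^ (4 * k)\<close>. As \<open>2 * l = 4 * k + 2\<close>, one more
  \<open>fr\<close> gives \<open>- a\<close> and, by \<open>card_power\<close>, also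
  \<open>a\<close>.\<close>

lemma no_common_antifixed_point:
  assumes "cj a = - a" and "fr a = - a"
  shows "a = 0"
proof -
  have "a ^ (q ^ (4 * i)) = a" for i
  proof (induction i)
    case (Suc i)
    have "a ^ (q ^ (4 * Suc i)) = fr (fr (a ^ (q ^ (4 * i))))"
    proof -
      have "4 * Suc i = 4 * i + 2 + 2" by simp
      then show ?thesis by (simp only: pow_pow)
    qed
    then show ?case
      by (simp only: Suc assms pow_minus minus_minus)
  qed simp
  from this[of k] have "a = a ^ (q ^ (4 * k))" ..
  then have "fr a = a ^ (q ^ (4 * k + 2))"
    by (metis pow_pow)
  also have "\<dots> = a"
    using card_power[of a] by (simp add: l_eq)
  finally show ?thesis
    using assms eq_minus_self_iff by auto
qed

section \<open>The map \<open>G\<close> on antifixed elements\<close>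

lemma P_G_eq: "P_G r q l x = P_H r q k (x - cj x)"
proof -
  have "(l - 1) div 2 = k"
    by (simp add: l_eq)
  then show ?thesis
    by (simp only: P_G_def P_H_def Let_def)
qed

lemma additive_P_H: "additive (P_H r q k :: 'a \<Rightarrow> 'a)"
  by standard (simp only: P_H_def pow_add distrib_left sum.distrib add_ac)

lemma cj_P_H:
  assumes "cj t = - t"
  shows "cj (P_H r q k t) = - P_H r q k t"
proof -
  have cj_pow: "cj (t ^ (q ^ n)) = - (t ^ (q ^ n))" for n
    using assms by (metis add.commute pow_minus pow_pow)
  show ?thesis
    by (simp only: P_H_def pow_add pow_sum pow_sign cj_pow mult_minus_right sum_negf minus_add_distrib)
qed

text \<open>\<open>fr\<close> sends each summand to minus the next one of the same sum, so only end
  terms survive. The two sums fit together: \<open>a (Suc k)\<close> equals \<open>b 0\<close>, and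
  \<open>b k\<close> is \<open>- t\<close>.\<close>

lemma P_H_telescope:
  assumes t: "cj t = - t"
  shows "P_H 0 q k t + fr (P_H 0 q k t) = 2 * t"
proof -
  define a where "a i = (-1) ^ i * t ^ (q ^ (2 * i))" for i
  define b where "b j = (-1) ^ (k + j) * t ^ (q ^ (2 * j + 1))" for j
  have fr_a: "fr (a i) = - a (Suc i)" and fr_b: "fr (b i) = - b (Suc i)" for i
    by (simp_all only: a_def b_def pow_sign pow_pow) simp_all
  have tele: "sum h {..n} - sum (\<lambda>i. h (Suc i)) {..n} = h 0 - h (Suc n)" for h :: "nat \<Rightarrow> 'a" and n
    by (simp add: sum_telescope flip: sum_subtractf)
  have "P_H 0 q k t = sum a {..k} + sum b {..k - 1}"
    by (simp add: P_H_def a_def b_def atMost_atLeast0)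
  then have "P_H 0 q k t + fr (P_H 0 q k t) =
      (sum a {..k} - sum (\<lambda>i. a (Suc i)) {..k}) + (sum b {..k-1} - sum (\<lambda>i. b (Suc i)) {..k-1})"
    by (simp add: pow_add pow_sum fr_a fr_b sum_negf)
  \<comment> \<open>Since \<open>k > 0\<close>, \<open>Suc (k - 1)\<close> is \<open>k\<close>, so
    the second difference ends at \<open>b k\<close>.\<close>
  also have "\<dots> = (a 0 - a (Suc k)) + (b 0 - b k)"
    using k_pos by (simp add: tele)
  also have "a (Suc k) = (-1) ^ Suc k * (cj t) ^ q"
    by (simp add: a_def l_eq mult_ac flip: power_mult)
  also have "b k = cj t"
    by (simp add: b_def l_eq)
  also have "a 0 = t"
    by (simp add: a_def)
  also have "b 0 = (-1) ^ k * t ^ q"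
    by (simp add: b_def)
  finally show ?thesis
    using q_odd by (simp add: t)
qed

section \<open>The substitutions and the product identity\<close>

definition M :: "'a \<Rightarrow> 'a" where "M x = v * x + cj x"
definition N :: "'a \<Rightarrow> 'a" where "N x = x + u * cj x"
text \<open>The halves \<open>(z + cj z) / 2\<close> and \<open>(z - cj z) / 2\<close> are the fixed
  and antifixed parts of \<open>z\<close>. The outer division by 2 is what remains of the factor 1/4
  in \<open>P_mult\<close>.\<close>

definition L :: "nat \<Rightarrow> 'a \<Rightarrow> 'a" where
  "L r z = (z + cj z) / 2 + P_H r q k ((z - cj z) / 2) / 2"
definition B :: "'a \<Rightarrow> 'a \<Rightarrow> 'a" where
  "B x y = (x * cj y + cj x * y) + (v * (x * fr y + fr x * y) + u * cj (x * fr y + fr x * y))"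

lemma additive_M: "additive M" and additive_N: "additive N"
  by (simp_all add: additive_def M_def N_def pow_add algebra_simps)

lemma additive_L: "additive (L r)"
proof
  fix x y
  have half: "(x + y - (cj x + cj y)) / 2 = (x - cj x) / 2 + (y - cj y) / 2"
    by (simp add: add_divide_distrib diff_divide_distrib)
  show "L r (x + y) = L r x + L r y"
    unfolding L_def pow_add half additive.add[OF additive_P_H]
    by (simp add: add_divide_distrib)
qed

text \<open>Conjugating \<open>x = - (u * cj x)\<close> gives \<open>cj x = v * x\<close>, because
  \<open>u * cj u = -1\<close>. Substituting back yields \<open>x = - x\<close>.\<close>

lemma inj_N: "inj N"
proof (rule additive_injI[OF additive_N])
  fix x assume "N x = 0"
  then have eq: "x = - (u * cj x)"
    by (simp add: N_def add_eq_0_iff2)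
  then have "cj x = - (cj u * cj (cj x))"
    by (metis pow_minus power_mult_distrib)
  then have "cj x = v * x"
    by (simp add: cj_u)
  moreover have "u * (v * x) = x"
    using u_nonzero by simp
  ultimately have "x = - x"
    using eq by metis
  then show "x = 0"
    by (simp only: eq_minus_self_iff)
qed

lemma inj_M: "inj M"
proof -
  have "M x = v * N x" for x
    using u_nonzero by (simp add: M_def N_def distrib_left)
  then show ?thesis
    using inj_N u_nonzero by (auto simp: inj_def)
qed

lemma cj_trace_part: "cj (x * cj y + cj x * y) = x * cj y + cj x * y"
  by (simp add: pow_add power_mult_distrib)

lemma cj_twisted_part: "cj (v * z + u * cj z) = - (v * z + u * cj z)"
  by (simp add: pow_add power_mult_distrib cj_u cj_v)

lemma L_sum:
  assumes "cj s = s" and "cj t = - t"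
  shows "L r (s + t) = s + P_H r q k t / 2"
proof -
  have *: "(s + t + cj (s + t)) / 2 = s" "(s + t - cj (s + t)) / 2 = t"
    using assms two by (simp_all add: pow_add)
  show ?thesis unfolding L_def * ..
qed

lemma P_mult_M_N: "P_mult r q l (M x) (N y) = L r (B x y)"
proof -
  let ?z = "x * fr y + fr x * y"
  let ?s = "x * cj y + cj x * y" and ?t = "v * ?z + u * cj ?z"
  have uv: "u * v = 1"
    using u_nonzero by simp
  have cjM: "cj (M x) = x - u * cj x" and cjN: "cj (N y) = cj y - v * y"
    by (simp_all add: M_def N_def pow_add power_mult_distrib cj_u cj_v)
  have frM: "fr (M x) = v * fr x + fr (cj x)" and frN: "fr (N y) = fr y + u * fr (cj y)"
    by (simp_all add: M_def N_def pow_add power_mult_distrib fr_v u_fixed)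
  have cjfrM: "cj (fr (M x)) = fr x - u * fr (cj x)" and cjfrN: "cj (fr (N y)) = fr (cj y) - v * fr y"
    by (simp_all add: cj_fr cjM cjN pow_diff power_mult_distrib fr_v u_fixed)
  have cjz: "cj ?z = cj x * fr (cj y) + fr (cj x) * cj y"
    by (simp add: pow_add power_mult_distrib cj_fr)
  have first: "M x * N y + cj (M x) * cj (N y) = 2 * ?s"
    unfolding cjM cjN unfolding M_def N_def
    using uv by (rule trace_part_identity)
  \<comment> \<open>\<open>w\<close> is the argument of \<open>P_G\<close>, which depends on it only
    through \<open>w - cj w\<close>.\<close>
  define w where "w = M x * fr (N y) + fr (M x) * N y"
  have cjw: "cj w = (x - u * cj x) * (fr (cj y) - v * fr y) + (fr x - u * fr (cj x)) * (cj y - v * y)"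
    by (simp only: w_def pow_add power_mult_distrib cjM cjN cjfrM cjfrN)
  have "w - cj w = 2 * ?t"
    unfolding cjw cjz unfolding w_def frM frN unfolding M_def N_def
    using uv by (rule twisted_part_identity)
  then have "P_G r q l w = 2 * P_H r q k ?t"
    by (simp only: P_G_eq mult_2 additive.add[OF additive_P_H])
  then have "P_mult r q l (M x) (N y) = 1 / 2 * (2 * ?s) + 1 / 4 * (2 * P_H r q k ?t)"
    by (simp only: P_mult_def first flip: w_def)
  moreover have "1 / 2 * (2 * a) + 1 / 4 * (2 * b) = a + b / 2" for a b :: 'a
  proof -
    have "(4::'a) = 2 * 2" by simp
    then have "(4::'a) \<noteq> 0" using two by (metis mult_eq_0_iff)
    with two show ?thesis by (simp add: field_simps)
  qed
  ultimately have "P_mult r q l (M x) (N y) = ?s + P_H r q k ?t / 2"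
    by (simp only:)
  also have "\<dots> = L r (?s + ?t)"
    by (rule L_sum[symmetric, OF cj_trace_part cj_twisted_part])
  finally show ?thesis by (simp add: B_def)
qed

text \<open>Only 0 is both fixed and antifixed, and \<open>P_H\<close> preserves the antifixed part,
  so both parts of a vanishing value are 0. Telescoping then gives
  \<open>2 * ?t = 0\<close>.\<close>

lemma inj_L_0: "inj (L 0)"
proof (rule additive_injI[OF additive_L])
  fix z assume Lz: "L 0 z = 0"
  let ?s = "(z + cj z) / 2" and ?t = "(z - cj z) / 2"
  have st: "cj ?s = ?s" "cj ?t = - ?t"
    by (simp_all only: power_divide pow_2 pow_add pow_diff cj_cj add.commute
        minus_divide_left minus_diff_eq)
  have z: "z = ?s + ?t"
    using two by (simp add: field_simps)
  have eq: "?s = - (P_H 0 q k ?t / 2)"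
    using Lz by (simp add: L_def add_eq_0_iff2)
  have "cj (P_H 0 q k ?t / 2) = - (P_H 0 q k ?t / 2)"
    by (simp only: power_divide pow_2 cj_P_H[OF st(2)] minus_divide_left)
  then have "?s = - ?s"
    by (metis eq pow_minus st(1))
  then have s0: "?s = 0"
    by (simp only: eq_minus_self_iff)
  then have "P_H 0 q k ?t = 0"
    using eq two by (metis divide_eq_0_iff neg_equal_0_iff_equal)
  then have "0 + fr 0 = 2 * ?t"
    using P_H_telescope[OF st(2)] by (simp only:)
  then have "2 * ?t = 0"
    using q_pos by (metis add_0 power_0_left zero_less_power less_irrefl)
  then show "z = 0"
    using z s0 two by (metis add_0 mult_eq_0_iff)
qed

section \<open>The BHB product has no zero divisors\<close>

text \<open>
  A zero divisor yields \<open>e \<noteq> 0\<close> antifixed by \<open>cj\<close> whose square is also the square of a fixed element: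
  the sign in \<open>u * cj u = -1\<close> is what makes this a contradiction.
\<close>

lemma B_no_zero_divisors:
  assumes xy: "B x y = 0"
  shows "x = 0 \<or> y = 0"
proof (rule ccontr)
  assume "\<not> (x = 0 \<or> y = 0)"
  then have nz: "x \<noteq> 0" "y \<noteq> 0" by auto
  let ?z = "x * fr y + fr x * y"
  let ?s = "x * cj y + cj x * y" and ?t = "v * ?z + u * cj ?z"
  have st: "?s + ?t = 0"
    using xy by (simp add: B_def)
  then have "cj (?s + ?t) = 0"
    using q_pos by simp
  then have "?s + - ?t = 0"
    by (simp only: pow_add[of ?s] cj_trace_part cj_twisted_part)
  with st have t0: "?t = 0"
    by (metis add_left_cancel eq_minus_self_iff)
  with st have s0: "?s = 0" by simp
  \<comment> \<open>After division by \<open>x\<close>, the equation \<open>?s = 0\<close> says that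
    \<open>c\<close> is antifixed. Then \<open>d\<close> is nonzero, as \<open>c\<close> is not also
    negated by \<open>fr\<close>.\<close>
  define c where "c = y / x"
  define d where "d = fr c + c"
  have c: "cj c = - c"
    using s0 nz by (simp add: c_def power_divide field_simps eq_neg_iff_add_eq_0)
  then have d: "cj d = - d"
    by (simp add: d_def pow_add cj_fr pow_minus)
  have "d \<noteq> 0"
    using no_common_antifixed_point[OF c] nz by (auto simp: d_def c_def eq_neg_iff_add_eq_0)
  have z: "?z = x * fr x * d"
    using nz by (simp add: d_def c_def power_divide field_simps)
  define e where "e = v * x * fr x"
  have e: "cj e = - e"
  proof -
    have "e * d - u * cj (x * fr x) * d = 0"
      using t0 unfolding z by (simp add: power_mult_distrib d e_def mult.assoc)
    then have "e = u * cj (x * fr x)"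
      using \<open>d \<noteq> 0\<close> by (simp flip: left_diff_distrib)
    moreover have "cj e = - (u * cj (x * fr x))"
      by (simp add: e_def power_mult_distrib cj_v)
    ultimately show ?thesis by simp
  qed
  \<comment> \<open>A fixed square root of \<open>(x * cj x) ^ (q\<^sup>2 + 1)\<close>; the exponent
    is even because \<open>q\<close> is odd.\<close>
  define n where "n = (x * cj x) ^ ((q\<^sup>2 + 1) div 2)"
  have cj_n: "cj n = n"
  proof -
    have "cj (x * cj x) = x * cj x"
      by (simp add: power_mult_distrib mult.commute)
    then show ?thesis
      by (metis n_def power_mult mult.commute)
  qed
  have "e\<^sup>2 = - (e * cj e)"
    by (simp add: e power2_eq_square)
  also have "\<dots> = (x * cj x) * fr (x * cj x)"
    using u_nonzero by (simp add: e_def power_mult_distrib cj_v cj_fr)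
  also have "\<dots> = (x * cj x) ^ (q\<^sup>2 + 1)"
    by simp
  also have "\<dots> = n\<^sup>2"
  proof -
    have "(q\<^sup>2 + 1) div 2 * 2 = q\<^sup>2 + 1"
      using q_odd by (intro dvd_div_mult_self) simp
    then show ?thesis
      by (simp only: n_def flip: power_mult)
  qed
  finally have "e = n \<or> e = - n"
    by (simp add: power2_eq_iff)
  then have "cj e = e"
    using cj_n by (auto simp: pow_minus)
  then have "e = 0"
    using e eq_minus_self_iff by metis
  then show False
    using nz u_nonzero by (simp add: e_def)
qed

lemma presemifield_B: "presemifield B"
  unfolding presemifield_def
  using B_no_zero_divisors by (simp add: B_def pow_add algebra_simps)

text \<open>For \<beta> the inverse of \<open>u * \<omega>\<close>, conjugation gives
  \<open>cj \<beta> = u / \<omega>\<close>, since both \<open>cj u\<close> and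
  \<open>cj \<omega>\<close> carry a minus sign. Hence \<open>\<beta> * \<omega> = v\<close> and
  \<open>cj \<beta> * \<omega> = u\<close>.\<close>

lemma BHB_mult_eq_B:
  assumes "\<omega> \<noteq> 0" and "cj \<omega> = - \<omega>" and "p ^ m = q ^ l" and "p ^ s = q\<^sup>2"
  shows "BHB_mult p m s (inverse (u * \<omega>)) \<omega> = B"
  unfolding BHB_mult_def B_def assms(3,4)
  using assms(1) u_nonzero
  by (simp add: fun_eq_iff power_inverse power_mult_distrib cj_u assms(2) field_simps)

end

section \<open>Choice of the parameters\<close>

theorem theorem4p5:
  fixes q l :: nat
  assumes "primepow q" and "odd q" and "odd l" and "l > 1"
    and "CARD('a::{field,finite}) = q ^ (2 * l)"
  shows "\<exists>p m s (\<beta>::'a) \<omega>. BHB_parameters p m s \<beta> \<omega> \<and>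
           isotopic (P_mult 0 q l) (BHB_mult p m s \<beta> \<omega>) \<and>
           (presemifield (P_mult 1 q l :: 'a \<Rightarrow> 'a \<Rightarrow> 'a) \<longrightarrow>
              isotopic (P_mult 1 q l) (BHB_mult p m s \<beta> \<omega>))"
proof -
  obtain p e where p: "prime p" "e > 0" "q = p ^ e"
    using assms(1) by (auto simp: primepow_def)
  obtain k where k: "l = 2 * k + 1" "k > 0"
    using assms(3,4) by (auto elim: oddE)
  have "odd p"
    using assms(2) p by auto
  have q: "q > 1"
    using assms(1) primepow_gt_Suc_0 by force
  have card: "CARD('a) = p ^ (2 * (e * l))"
    using assms(5) p by (simp add: mult_ac flip: power_mult)
  have char: "CHAR('a) = p"
    using card p(1) by (rule finite_field_CHAR)
  have two: "(2::'a) \<noteq> 0"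
  proof
    assume "(2::'a) = 0"
    then have "of_nat 2 = (0::'a)" by simp
    then have "p dvd 2"
      unfolding of_nat_eq_0_iff_char_dvd char .
    then show False
      using p(1) \<open>odd p\<close> by (metis primes_dvd_imp_eq two_is_prime_nat)
  qed
  define Q where "Q = q ^ l"
  have Q: "odd Q" "Q > 1"
    using assms(2,4) q by (simp_all add: Q_def one_less_power del: One_nat_def)
  have QQ: "CARD('a) - 1 = (Q - 1) * (Q + 1)"
  proof -
    have "CARD('a) = Q * Q"
      by (simp add: assms(5) Q_def mult_2 power_add)
    then show ?thesis
      using Q(2) by (cases Q) simp_all
  qed
  have card_q: "(q - 1) * (q + 1) dvd CARD('a) - 1"
  proof -
    have "int q ^ 2 - 1 dvd (int q ^ 2) ^ l - 1"
      using power_diff_1_eq[of "(int q)\<^sup>2" l] by simp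
    then have "int (q\<^sup>2 - 1) dvd int ((q\<^sup>2) ^ l - 1)"
      using q by (simp add: of_nat_diff)
    then have "q\<^sup>2 - 1 dvd (q\<^sup>2) ^ l - 1"
      by (simp only: int_dvd_int_iff)
    moreover have "q\<^sup>2 - 1 = (q - 1) * (q + 1)"
      by (cases q) (simp_all add: power2_eq_square)
    ultimately show ?thesis
      by (simp only: assms(5) power_mult)
  qed
  obtain g :: 'a where g: "g \<noteq> 0" "g ^ ((CARD('a) - 1) div 2) = -1"
    using finite_field_exists_nonsquare[where 'a = 'a] assms(2,5) by auto
  \<comment> \<open>The exponent is chosen so that \<omega> to the power \<open>Q - 1\<close> is
    \<open>g ^ ((Q\<^sup>2 - 1) div 2) = -1\<close>.\<close>
  define \<omega> where "\<omega> = g ^ ((Q + 1) div 2)"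
  have \<omega>_nz: "\<omega> \<noteq> 0"
    using g by (simp add: \<omega>_def)
  have \<omega>_pow: "\<omega> ^ (Q - 1) = -1"
  proof -
    have "(Q + 1) div 2 * (Q - 1) = (CARD('a) - 1) div 2"
      using Q unfolding QQ by (auto elim!: oddE)
    then show ?thesis
      using g by (simp add: \<omega>_def flip: power_mult)
  qed
  have \<omega>: "\<omega> ^ Q = - \<omega>"
    using \<omega>_pow Q by (metis mult_minus1 power_minus_mult zero_less_one order.strict_trans)
  \<comment> \<open>\<open>q + 1\<close> still divides half of \<open>CARD('a) - 1\<close>, because
    \<open>q - 1\<close> supplies the factor 2. Thus a power of \<open>g\<close> has
    \<open>(q + 1)\<close>-th power -1.\<close>
  obtain t where t: "(CARD('a) - 1) div 2 = t * (q + 1)"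
  proof -
    from card_q obtain r where r: "CARD('a) - 1 = (q - 1) * (q + 1) * r" ..
    have "even (q - 1)"
      using assms(2) by simp
    then obtain h where "q - 1 = 2 * h" ..
    with r have "CARD('a) - 1 = 2 * ((h * r) * (q + 1))"
      by (simp only: mult_ac)
    then have "(CARD('a) - 1) div 2 = (h * r) * (q + 1)"
      by simp
    then show ?thesis by (rule that)
  qed
  define u where "u = g ^ t"
  have u: "u ^ (q + 1) = -1"
    using g(2) unfolding t u_def power_mult .
  have u_fixed: "u ^ (q\<^sup>2) = u"
  proof -
    have "q\<^sup>2 = (q + 1) * (q - 1) + 1"
      using q by (simp add: power2_eq_square algebra_simps)
    then have "u ^ (q\<^sup>2) = u ^ ((q + 1) * (q - 1)) * u"
      by (simp only: power_add[of u _ 1] power_one_right)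
    also have "\<dots> = (-1) ^ (q - 1) * u"
      by (simp only: u power_mult)
    finally show ?thesis
      using assms(2) by simp
  qed
  have fixed: "x ^ (q ^ (2 * l)) = x" for x :: 'a
  proof (cases "x = 0")
    case False
    have "x ^ CARD('a) = x ^ (CARD('a) - 1) * x"
      by (rule power_minus_mult[symmetric]) (simp add: finite_UNIV_card_ge_0)
    then show ?thesis
      using finite_field_power_card_minus_1[OF False] by (simp only: assms(5) mult_1)
  qed (use q in simp)
  interpret quadratic_extension q l k u
  proof
    show "(x + y) ^ q = x ^ q + y ^ q" for x y :: 'a
      by (rule freshmans_dream'[of q e]) (use p char in simp_all)
  qed (use assms k two fixed u u_fixed in simp_all)
  define m where "m = e * l"
  define s where "s = 2 * e"
  have pm: "p ^ m = q ^ l" and ps: "p ^ s = q\<^sup>2"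
    using p by (simp_all add: m_def s_def power_mult mult.commute[of 2])
  define \<beta> where "\<beta> = inverse (u * \<omega>)"
  have B: "BHB_mult p m s \<beta> \<omega> = B"
    unfolding \<beta>_def using \<omega>_nz \<omega>[unfolded Q_def] pm ps by (rule BHB_mult_eq_B)
  \<comment> \<open>Modulo a common divisor, \<open>q\<^sup>2\<close> and \<open>q ^ l\<close> are
    both -1. Then \<open>q ^ (2 * l)\<close> is \<open>(-1) ^ l = -1\<close> and also 1, so the
    divisor divides 2.\<close>
  have gcd: "gcd (p ^ m + 1) (p ^ s + 1) = 2"
  proof -
    let ?d = "gcd (q ^ l + 1) (q\<^sup>2 + 1)"
    have d1: "[(int q)\<^sup>2 = -1] (mod int ?d)"
    proof -
      have "int ?d dvd int (q\<^sup>2 + 1)"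
        by (simp only: int_dvd_int_iff gcd_dvd2)
      then show ?thesis by (simp add: cong_iff_dvd_diff add.commute)
    qed
    have d2: "[int q ^ l = -1] (mod int ?d)"
    proof -
      have "int ?d dvd int (q ^ l + 1)"
        by (simp only: int_dvd_int_iff gcd_dvd1)
      then show ?thesis by (simp add: cong_iff_dvd_diff add.commute)
    qed
    have "[(int q ^ l)\<^sup>2 = (-1) ^ l] (mod int ?d)"
      using cong_pow[OF d1, of l] by (simp add: mult.commute flip: power_mult)
    moreover have "[(int q ^ l)\<^sup>2 = 1] (mod int ?d)"
      using cong_pow[OF d2, of 2] by simp
    ultimately have "[-1 = 1] (mod int ?d)"
      using assms(3) by (simp add: cong_def)
    then have "int ?d dvd int 2"
      by (simp add: cong_iff_dvd_diff)
    then have "?d dvd 2"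
      by (simp only: int_dvd_int_iff)
    moreover have "2 dvd ?d"
      using assms(2) by simp
    ultimately show ?thesis
      unfolding pm ps by (rule dvd_antisym)
  qed
  \<comment> \<open>With the gcd equal to 2, this says that \<beta> is a nonsquare. The exponent
    factors as \<open>(Q + 1) * ((Q - 1) div 2)\<close>, and the norm of \<open>u * \<omega>\<close>
    is \<open>\<omega>\<^sup>2\<close>.\<close>
  have "\<beta> ^ ((p ^ (2 * m) - 1) div gcd (p ^ m + 1) (p ^ s + 1)) = -1"
  proof -
    have "(p ^ (2 * m) - 1) div 2 = (Q + 1) * ((Q - 1) div 2)"
      using Q QQ unfolding m_def card[symmetric] by (auto elim!: oddE)
    moreover have "(u * \<omega>) ^ (Q + 1) = \<omega>\<^sup>2"
      using u_nonzero cj_u \<omega> by (simp add: power_mult_distrib power2_eq_square flip: Q_def)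
    moreover have "(\<omega>\<^sup>2) ^ ((Q - 1) div 2) = -1"
      using Q \<omega>_pow by (simp flip: power_mult)
    ultimately have "(u * \<omega>) ^ ((p ^ (2 * m) - 1) div 2) = -1"
      by (simp only: power_mult)
    then show ?thesis
      unfolding gcd \<beta>_def power_inverse by simp
  qed
  moreover have "(-1::'a) \<noteq> 1"
    using two by (metis add.right_inverse one_add_one)
  ultimately have \<beta>: "\<beta> ^ ((p ^ (2 * m) - 1) div gcd (p ^ m + 1) (p ^ s + 1)) \<noteq> 1"
    by simp
  have "l \<le> m"
    using p(2) by (simp add: m_def)
  then have "m > 1"
    using assms(4) by simp
  moreover have "0 < s" "s < 2 * m"
    using p(2) assms(4) by (simp_all add: m_def s_def)
  moreover have "\<omega> \<notin> {x. x ^ (p ^ m) = x}" "\<omega> ^ (p ^ m) = - \<omega>"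
    using \<omega> \<omega>_nz eq_minus_self_iff[of \<omega>] by (auto simp: pm Q_def)
  moreover have "\<beta> \<noteq> 0"
    using \<omega>_nz u_nonzero by (simp add: \<beta>_def)
  moreover have "\<not> (\<exists>a::'a. a \<noteq> 0 \<and> a + a ^ (p ^ m) = 0 \<and> a + a ^ (p ^ s) = 0)"
    unfolding pm ps by (metis add_eq_0_iff no_common_antifixed_point)
  ultimately have params: "BHB_parameters p m s \<beta> \<omega>"
    unfolding BHB_parameters_def
    using p(1) \<open>odd p\<close> \<beta> card[folded m_def] by blast
  note maps = additive_M inj_M additive_N inj_N additive_L
  have "isotopic (P_mult 0 q l) B"
    using presemifield_B maps inj_L_0 P_mult_M_N by (rule isotopicI)
  moreover have "isotopic (P_mult 1 q l) B" if "presemifield (P_mult 1 q l :: 'a \<Rightarrow> 'a \<Rightarrow> 'a)"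
  proof -
    have "inj (L 1)"
      using that presemifield_B maps P_mult_M_N by (rule inj_if_presemifield)
    with presemifield_B maps show ?thesis
      using P_mult_M_N by (rule isotopicI)
  qed
  ultimately show ?thesis
    using params B by metis
qed

end
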